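(* Let $\alpha\in\mathbb N_0^4$ and $\gamma\in\mathbb N_0^3$ be such that $\mathcal S_\gamma^\alpha$ is finite, and assume $\alpha_0\ge1$. Suppose that there exists an index $k\in\{1,2,3\}$ with $\gamma_k\ge1$ such that every critical inequality among $$\gamma_i\le\alpha_0+\alpha_i+1\quad(i=1,2,3),\qquad \gamma_i+\gamma_j\le\alpha_0+\alpha_i+\alpha_j+2\quad(1\le i<j\le3)$$ involves the index $k$. Then $$\mathcal S_\gamma^\alpha=\mathcal S_{\gamma-\mathbf e_k}^{\alpha-\mathbf e_0}-\mathcal S_\gamma^{\alpha-\mathbf e_0+\mathbf e_k},$$ and both moments on the right-hand side are finite.
   Context: Let $T\subset\mathbb R^3$ be a tetrahedron with barycentric coordinates $\lambda_0,\dots,\lambda_3$. For $\alpha=(\alpha_0,\alpha_1,\alpha_2,\alpha_3)\in\mathbb N_0^4$ and $\gamma=(\gamma_1,\gamma_2,\gamma_3)\in\mathbb N_0^3$ the star moment is $$\mathcal S_\gamma^\alpha=|T|^{-1}\int_T\frac{\lambda_0^{\alpha_0}\lambda_1^{\alpha_1}\lambda_2^{\alpha_2}\lambda_3^{\alpha_3}}{(\lambda_0+\lambda_1)^{\gamma_1}(\lambda_0+\lambda_2)^{\gamma_2}(\lambda_0+\lambda_3)^{\gamma_3}}\,\mathrm dx\in[0,\infty].$$ It is finite if and only if all the inequalities displayed in the claim hold. An inequality is called critical if it holds with equality; the inequality for $i$ involves the index $i$, the inequality for the pair $i<j$ involves the indices $i$ and $j$. In upper indices $\mathbf e_0,\dots,\mathbf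 e_3$ are the canonical unit vectors of $\mathbb N_0^4$ (indexed from $0$); in lower indices $\mathbf e_1,\mathbf e_2,\mathbf e_3$ are the canonical unit vectors of $\mathbb N_0^3$. *)

theory Defs
  imports "HOL-Analysis.Analysis"
begin

text \<open>
  Vertices, barycentric coordinates and multi-indices are functions on \<^typ>\<open>nat\<close>:
  vertices and upper multi-indices are read only at \<open>0, \<dots>, 3\<close>, and lower
  multi-indices only at \<open>1, 2, 3\<close>.
\<close>

definition tetrahedron_vertices :: "(nat \<Rightarrow> real^3) \<Rightarrow> bool" where
  "tetrahedron_vertices v \<longleftrightarrow> inj_on v {0..3} \<and> \<not> affine_dependent (v ` {0..3})"

definition tetrahedron :: "(nat \<Rightarrow> real^3) \<Rightarrow> (real^3) set" where
  "tetrahedron v = convex hull (v ` {0..3})"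

text \<open>The clause for indices beyond 3 only serves to make the function unique.\<close>

definition barycentric :: "(nat \<Rightarrow> real^3) \<Rightarrow> real^3 \<Rightarrow> nat \<Rightarrow> real" where
  "barycentric v x = (THE u. (\<Sum>i=0..3. u i) = 1 \<and> (\<Sum>i=0..3. u i *\<^sub>R v i) = x
     \<and> (\<forall>i>3. u i = 0))"

text \<open>
  The value is in \<open>[0,\<infinity>]\<close>. The denominator vanishes only on (at most three) edges
  of the tetrahedron, a null set, so the convention for division by 0 is irrelevant.
\<close>

definition star_moment ::
    "(nat \<Rightarrow> real^3) \<Rightarrow> (nat \<Rightarrow> nat) \<Rightarrow> (nat \<Rightarrow> nat) \<Rightarrow> ennreal" where
  "star_moment v \<alpha> \<gamma> =
     (\<integral>\<^sup>+ x \<in> tetrahedron v.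
        ennreal (\<Prod>i=0..3. barycentric v x i ^ \<alpha> i)
        / ennreal (\<Prod>i=1..3. (barycentric v x 0 + barycentric v x i) ^ \<gamma> i) \<partial>lborel)
     / emeasure lborel (tetrahedron v)"

definition canonical_unit :: "nat \<Rightarrow> nat \<Rightarrow> nat" where
  "canonical_unit k = (\<lambda>i. if i = k then 1 else 0)"

end

theory Submission imports Defs begin

text \<open>
  The identity is pointwise: multiplying and dividing by \<open>\<lambda>\<^sub>0 + \<lambda>\<^sub>k\<close> gives
  \<open>\<lambda>^(\<alpha> - e\<^sub>0) / (\<lambda>\<^sub>0 + \<lambda>\<^sub>*)^(\<gamma> - e\<^sub>k) = (\<lambda>\<^sub>0 + \<lambda>\<^sub>k) \<lambda>^(\<alpha> - e\<^sub>0) / (\<lambda>\<^sub>0 + \<lambda>\<^sub>*)^\<gamma>\<close> in multi-index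
  notation, where \<open>\<lambda>\<^sub>0 + \<lambda>\<^sub>*\<close> has the entries \<open>\<lambda>\<^sub>0 + \<lambda>\<^sub>i\<close>, and the right-hand side is the
  sum of the integrands with exponents \<open>(\<alpha>, \<gamma>)\<close> and \<open>(\<alpha> - e\<^sub>0 + e\<^sub>k, \<gamma>)\<close> (lemma
  \<open>star_moment_split\<close>). Subtracting moments therefore only requires that the moment with
  exponents \<open>(\<alpha> - e\<^sub>0 + e\<^sub>k, \<gamma>)\<close> be finite.

  Finiteness is decided by the inequalities \<open>\<gamma>\<^sub>i \<le> \<alpha>\<^sub>0 + \<alpha>\<^sub>i + 1\<close> and
  \<open>\<gamma>\<^sub>i + \<gamma>\<^sub>j \<le> \<alpha>\<^sub>0 + \<alpha>\<^sub>i + \<alpha>\<^sub>j + 2\<close>, and both directions of this criterion are used. They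
  are necessary, so they hold for \<open>(\<alpha>, \<gamma>)\<close> (lemmas \<open>star_moment_finite_imp_single\<close> and
  \<open>star_moment_finite_imp_pair\<close>). Passing from \<open>\<alpha>\<close> to \<open>\<alpha> - e\<^sub>0 + e\<^sub>k\<close> leaves the right-hand
  sides that involve \<open>k\<close> unchanged and lowers the others by one; the latter are not critical,
  and all quantities are integers, so the inequalities survive. They are also sufficient
  (lemma \<open>star_moment_finiteI\<close>), which gives the finiteness sought.

  Everything is computed in charts: on the tetrahedron, three of the barycentric coordinates,
  \<open>\<lambda>\<^sub>0\<close>, \<open>\<lambda>\<^sub>i\<close> and \<open>\<lambda>\<^sub>j\<close>, are affine coordinates, and the moment is a positive constant times
  an integral over the standard simplex of \<open>\<real>\<^sup>3\<close> (lemma \<open>star_moment_chart\<close>).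

  Sufficiency: the only singularities lie on the face opposite to vertex 0. There some
  \<open>\<lambda>\<^sub>m\<close> with \<open>m \<noteq> 0\<close> is at least 1/4, and under the inequalities the powers of \<open>\<lambda>\<^sub>0\<close> can be
  shared out between the two other factors so that the integrand is bounded by a multiple
  of \<open>1 / ((\<lambda>\<^sub>0 + \<lambda>\<^sub>i) (\<lambda>\<^sub>0 + \<lambda>\<^sub>j))\<close>. This is at most
  \<open>(\<lambda>\<^sub>0 \<lambda>\<^sub>i \<lambda>\<^sub>j)\<close> to the power \<open>-2/3\<close>, an integrable product of functions of one variable.

  Necessity: if an inequality fails, infinitely many disjoint blocks shrinking geometrically
  towards an edge (for a single index) or a vertex (for a pair) of that face each contribute
  at least the same positive amount to the integral.
\<close>


section \<open>Affine substitution in nonnegative integrals\<close>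

text \<open>
  The constant is the absolute value of the determinant of \<open>h\<close>, but only its being
  positive and finite matters: every moment is normalised by the volume of the tetrahedron.
  Measurability is asked of the pulled-back function, which is the one given by an
  explicit formula in the application.
\<close>

lemma nn_integral_affine_substitution:
  fixes h :: "real^'n::{finite,wellorder} \<Rightarrow> real^'n::_"
  assumes h: "linear h" and inj: "inj h"
  obtains c :: ennreal where "c \<noteq> 0" "c < \<infinity>"
    "\<And>f. (\<lambda>y. f (b + h y)) \<in> borel_measurable borel \<Longrightarrow>
       (\<integral>\<^sup>+x. f x \<partial>lborel) = c * (\<integral>\<^sup>+y. f (b + h y) \<partial>lborel)"
proof -
  obtain k where k: "linear k" and kh: "\<And>y. k (h y) = y" and hk: "\<And>x. h (k x) = x"
    using linear_injective_isomorphism[OF h inj] by blast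
  define d where "d = \<bar>det (matrix k)\<bar>"
  have injk: "inj k" by (metis hk injI)
  have d: "d > 0" unfolding d_def using det_nz_iff_inj[OF k] injk by simp
  define c where "c = ennreal (1 / d)"
  have [measurable]: "h \<in> borel_measurable borel" "k \<in> borel_measurable borel"
    using h k by (auto intro!: borel_measurable_continuous_onI linear_continuous_on linear_conv_bounded_linear[THEN iffD1])
  have lborel_eq: "lborel = density (distr lborel borel (\<lambda>y. b + h y)) (\<lambda>_. c)"
  proof (rule lborel_eqI)
    fix l u :: "real^'n::_" assume lu: "\<And>i. i \<in> Basis \<Longrightarrow> l \<bullet> i \<le> u \<bullet> i"
    have pre: "(\<lambda>y. b + h y) -` box l u = k ` box (l - b) (u - b)"
    proof (intro set_eqI iffI)
      fix y assume "y \<in> (\<lambda>y. b + h y) -` box l u"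
      then have "h y \<in> box (l - b) (u - b)"
        by (auto simp: mem_box algebra_simps inner_simps)
      then show "y \<in> k ` box (l - b) (u - b)" by (metis kh image_eqI)
    next
      fix y assume "y \<in> k ` box (l - b) (u - b)"
      then show "y \<in> (\<lambda>y. b + h y) -` box l u"
        by (auto simp: mem_box algebra_simps inner_simps hk)
    qed
    have lm: "k ` box (l - b) (u - b) \<in> lmeasurable"
      by (rule measurable_linear_image[OF k]) simp
    have "k ` box (l - b) (u - b) \<in> sets borel"
      unfolding pre[symmetric] by (rule measurable_sets_borel[of _ borel]) measurable
    then have "emeasure lborel (k ` box (l - b) (u - b)) = emeasure lebesgue (k ` box (l - b) (u - b))"
      by simp
    also have "\<dots> = ennreal (measure lebesgue (k ` box (l - b) (u - b)))"
      using lm by (rule emeasure_eq_measure2)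
    also have "\<dots> = ennreal (d * measure lebesgue (box (l - b) (u - b)))"
      by (subst measure_linear_image[OF k]) (simp_all add: d_def)
    also have "measure lebesgue (box (l - b) (u - b)) = (\<Prod>i\<in>Basis. (u - l) \<bullet> i)"
      using lu by (subst measure_completion) (auto simp: measure_lborel_box_eq inner_simps)
    finally have e: "emeasure lborel (k ` box (l - b) (u - b)) = ennreal (d * (\<Prod>i\<in>Basis. (u - l) \<bullet> i))" .
    show "emeasure (density (distr lborel borel (\<lambda>y. b + h y)) (\<lambda>_. c)) (box l u)
        = ennreal (\<Prod>i\<in>Basis. (u - l) \<bullet> i)"
      using d by (simp add: emeasure_density nn_integral_cmult_indicator emeasure_distr pre e c_def ennreal_mult'[symmetric])
  qed simp
  show ?thesis
  proof
    show "c \<noteq> 0" "c < \<infinity>" using d by (auto simp: c_def)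
    fix f :: "real^'n::_ \<Rightarrow> ennreal"
    assume m [measurable]: "(\<lambda>y. f (b + h y)) \<in> borel_measurable borel"
    have "(\<lambda>x. (\<lambda>y. f (b + h y)) (k (x - b))) \<in> borel_measurable borel"
      by measurable
    then have [measurable]: "f \<in> borel_measurable borel" by (simp add: hk)
    show "(\<integral>\<^sup>+x. f x \<partial>lborel) = c * (\<integral>\<^sup>+y. f (b + h y) \<partial>lborel)"
      by (subst lborel_eq) (simp add: nn_integral_density nn_integral_distr nn_integral_cmult)
  qed
qed

section \<open>Barycentric coordinates\<close>

text \<open>
  Affine independence makes the coefficients unique, so the definite description in the
  definition of \<^const>\<open>barycentric\<close> picks them out.
\<close>

lemma barycentric_affine_combination:
  assumes v: "tetrahedron_vertices v" and u: "(\<Sum>i=0..3. u i) = 1" "\<forall>i>3. u i = 0"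
  shows "barycentric v (\<Sum>i=0..3. u i *\<^sub>R v i) = u"
  unfolding barycentric_def
proof (rule the_equality)
  fix w assume w: "(\<Sum>i=0..3. w i) = 1 \<and> (\<Sum>i=0..3. w i *\<^sub>R v i) = (\<Sum>i=0..3. u i *\<^sub>R v i) \<and> (\<forall>i>3. w i = 0)"
  have inj: "inj_on v {0..3}" and ind: "\<not> affine_dependent (v ` {0..3})"
    using v by (auto simp: tetrahedron_vertices_def)
  define d where "d = (\<lambda>x. let i = the_inv_into {0..3} v x in w i - u i)"
  have dv: "d (v i) = w i - u i" if "i \<in> {0..3}" for i
    using that by (simp add: d_def the_inv_into_f_f[OF inj] Let_def)
  have "sum d (v ` {0..3}) = 0"
    using w u by (simp add: sum.reindex[OF inj] dv sum_subtractf)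
  moreover have "(\<Sum>x\<in>v ` {0..3}. d x *\<^sub>R x) = 0"
    using w by (simp add: sum.reindex[OF inj] dv sum_subtractf scaleR_diff_left)
  ultimately have "\<forall>x\<in>v ` {0..3}. d x = 0"
    using ind affine_dependent_explicit_finite[of "v ` {0..3}"] by auto
  then have "\<forall>i\<in>{0..3}. w i = u i" by (auto simp: dv)
  then show "w = u" using w u by (metis atLeastAtMost_iff ext le0 not_le)
qed (use u in auto)

lemma affine_combination_in_tetrahedron_iff:
  assumes v: "tetrahedron_vertices v" and u: "(\<Sum>i=0..3. u i) = 1" "\<forall>i>3. u i = 0"
  shows "(\<Sum>i=0..3. u i *\<^sub>R v i) \<in> tetrahedron v \<longleftrightarrow> (\<forall>i\<in>{0..3}. 0 \<le> u i)"
proof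
  have inj: "inj_on v {0..3}" using v by (simp add: tetrahedron_vertices_def)
  assume "(\<Sum>i=0..3. u i *\<^sub>R v i) \<in> tetrahedron v"
  then obtain w where w: "\<forall>x\<in>v ` {0..3}. 0 \<le> w x" "sum w (v ` {0..3}) = 1"
    "(\<Sum>x\<in>v ` {0..3}. w x *\<^sub>R x) = (\<Sum>i=0..3. u i *\<^sub>R v i)"
    by (auto simp: tetrahedron_def convex_hull_finite)
  define w' where "w' = (\<lambda>i. if i \<le> 3 then w (v i) else 0)"
  have "(\<Sum>i=0..3. w' i) = 1" "(\<Sum>i=0..3. w' i *\<^sub>R v i) = (\<Sum>i=0..3. u i *\<^sub>R v i)" "\<forall>i>3. w' i = 0"
    using w(2,3) by (simp_all add: sum.reindex[OF inj] w'_def)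
  then have "w' = u"
    using barycentric_affine_combination[OF v u] barycentric_affine_combination[OF v, of w'] by simp
  then show "\<forall>i\<in>{0..3}. 0 \<le> u i" using w(1) by (auto simp: w'_def)
next
  assume "\<forall>i\<in>{0..3}. 0 \<le> u i"
  then show "(\<Sum>i=0..3. u i *\<^sub>R v i) \<in> tetrahedron v"
    unfolding tetrahedron_def using u
    by (intro convex_sum) (auto intro: hull_inc)
qed

section \<open>The star moment in affine charts\<close>

definition star_weight :: "(nat \<Rightarrow> nat) \<Rightarrow> (nat \<Rightarrow> nat) \<Rightarrow> (nat \<Rightarrow> real) \<Rightarrow> real" where
  "star_weight \<alpha> \<gamma> u = (\<Prod>i=0..3. u i ^ \<alpha> i) / (\<Prod>i=1..3. (u 0 + u i) ^ \<gamma> i)"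

text \<open>
  The barycentric coordinates of the point with \<open>\<lambda>\<^sub>0, \<lambda>\<^sub>i, \<lambda>\<^sub>j\<close> equal to the entries of \<open>y\<close>,
  where \<open>m\<close> is the remaining vertex.
\<close>

definition simplex_point :: "nat \<Rightarrow> nat \<Rightarrow> nat \<Rightarrow> real^3 \<Rightarrow> nat \<Rightarrow> real" where
  "simplex_point i j m y = (\<lambda>n. if n = 0 then y$1 else if n = i then y$2 else if n = j then y$3
     else if n = m then 1 - y$1 - y$2 - y$3 else 0)"

text \<open>
  The coordinate hyperplanes are excluded so that the denominators never vanish; being null
  sets, they do not affect the integrals.
\<close>

definition corner_simplex :: "(real^3) set" where
  "corner_simplex = {y. 0 < y$1 \<and> 0 < y$2 \<and> 0 < y$3 \<and> y$1 + y$2 + y$3 \<le> 1}"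

lemma opposite_vertices:
  assumes "{i, j, m} = {1..3::nat}"
  shows "i \<noteq> j" "i \<noteq> m" "j \<noteq> m" "i \<noteq> 0" "j \<noteq> 0" "m \<noteq> 0" "{0..3} = {0, i, j, m}"
proof -
  have c: "card {i, j, m} = 3" using assms by simp
  show "i \<noteq> j" "i \<noteq> m" "j \<noteq> m" using c by (auto simp: card_insert_if split: if_splits)
  have "0 \<notin> {i, j, m}" unfolding assms by simp
  then show "i \<noteq> 0" "j \<noteq> 0" "m \<noteq> 0" by auto
  have "{0..3} = insert 0 {1..3::nat}" by auto
  then show "{0..3} = {0, i, j, m}" using assms by simp
qed

lemma complementary_vertex:
  assumes "i \<in> {1..3::nat}" "j \<in> {1..3}" "i \<noteq> j"
  obtains m where "{i, j, m} = {1..3}"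
proof -
  have "card ({1..3} - {i, j}) = 1" using assms by (simp add: card_Diff_subset)
  then obtain m where "{1..3} - {i, j} = {m}" by (rule card_1_singletonE)
  then show ?thesis using assms by (intro that[of m]) blast
qed

lemma complementary_vertices:
  assumes "i \<in> {1..3::nat}"
  obtains j m where "{i, j, m} = {1..3}"
proof -
  define j :: nat where "j = (if i = 1 then 2 else 1)"
  have "j \<in> {1..3}" "i \<noteq> j" by (auto simp: j_def)
  then show ?thesis using complementary_vertex[OF assms] that by blast
qed

lemma sum_vertices:
  assumes "{i, j, m} = {1..3::nat}"
  shows "(\<Sum>n=0..3. f n) = f 0 + f i + f j + (f m :: 'a::comm_monoid_add)"
  unfolding opposite_vertices(7)[OF assms]
  using opposite_vertices(1-6)[OF assms] by (simp add: ac_simps)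

lemma star_weight_eq:
  assumes "{i, j, m} = {1..3::nat}"
  shows "star_weight \<alpha> \<gamma> u =
    u 0 ^ \<alpha> 0 * (u i ^ \<alpha> i / (u 0 + u i) ^ \<gamma> i) * (u j ^ \<alpha> j / (u 0 + u j) ^ \<gamma> j)
      * (u m ^ \<alpha> m / (u 0 + u m) ^ \<gamma> m)"
proof -
  note opp = opposite_vertices[OF assms]
  have "(\<Prod>n=1..3. f n) = f i * f j * f m" for f :: "nat \<Rightarrow> real"
    unfolding assms[symmetric] using opp(1-6) by (simp add: ac_simps)
  moreover have "(\<Prod>n=0..3. f n) = f 0 * f i * f j * f m" for f :: "nat \<Rightarrow> real"
    unfolding opp(7) using opp(1-6) by (simp add: ac_simps)
  ultimately show ?thesis unfolding star_weight_def by simp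
qed

lemma simplex_point_sum:
  assumes "{i, j, m} = {1..3::nat}"
  shows "(\<Sum>n=0..3. simplex_point i j m y n) = 1" "\<forall>n>3. simplex_point i j m y n = 0"
proof -
  have "n \<notin> {0, i, j, m}" if "n > 3" for n
    using that unfolding opposite_vertices(7)[OF assms, symmetric] by simp
  then show "\<forall>n>3. simplex_point i j m y n = 0" by (auto simp: simplex_point_def)
  show "(\<Sum>n=0..3. simplex_point i j m y n) = 1"
    using opposite_vertices(1-6)[OF assms] by (simp add: sum_vertices[OF assms] simplex_point_def)
qed

lemma prod_Basis_real3:
  "(\<Prod>b\<in>(Basis :: (real^3) set). f b) = f (axis 1 1) * f (axis 2 1) * (f (axis 3 1) :: 'a::comm_monoid_mult)"
proof -
  have B: "(Basis :: (real^3) set) = (\<lambda>i. axis i 1) ` {1, 2, 3}"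
    unfolding Basis_vec_def UNIV_3 by auto
  have "inj_on (\<lambda>i::3. axis i (1::real)) {1, 2, 3}" by (auto intro!: inj_onI simp: axis_eq_axis)
  then show ?thesis unfolding B by (simp add: prod.reindex ac_simps)
qed

lemma emeasure_box_real3:
  fixes l u :: "real^3"
  assumes "\<And>i. l$i \<le> u$i"
  shows "emeasure lborel (box l u) = ennreal ((u$1 - l$1) * (u$2 - l$2) * (u$3 - l$3))"
proof -
  have "emeasure lborel (box l u) = ennreal (\<Prod>b\<in>Basis. (u - l) \<bullet> b)"
    using assms by (intro emeasure_lborel_box) (auto simp: Basis_vec_def inner_axis)
  then show ?thesis by (simp add: prod_Basis_real3 inner_axis)
qed

text \<open>
  The constant does not depend on the exponents, so that linear relations and inequalities
  between integrands pass to the moments; it has to be nonzero and finite so that moments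
  and chart integrals are finite at the same time.
\<close>

lemma star_moment_chart:
  assumes v: "tetrahedron_vertices v" and ijm: "{i, j, m} = {1..3::nat}"
  obtains C :: ennreal where "C \<noteq> 0" "C < \<infinity>"
    "\<And>\<alpha> \<gamma>. star_moment v \<alpha> \<gamma> =
       C * (\<integral>\<^sup>+ y \<in> corner_simplex. ennreal (star_weight \<alpha> \<gamma> (simplex_point i j m y)) \<partial>lborel)"
proof -
  note opp = opposite_vertices[OF ijm]
  let ?p = "simplex_point i j m"
  define h where "h y = y$1 *\<^sub>R (v 0 - v m) + y$2 *\<^sub>R (v i - v m) + y$3 *\<^sub>R (v j - v m)" for y :: "real^3"
  have comb: "(\<Sum>n=0..3. ?p y n *\<^sub>R v n) = v m + h y" for y
    using opp(1-6) by (simp add: sum_vertices[OF ijm] simplex_point_def h_def algebra_simps)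
  have bary: "barycentric v (v m + h y) = ?p y" for y
    using barycentric_affine_combination[OF v simplex_point_sum[OF ijm]] by (simp add: comb)
  define K where "K = {y :: real^3. 0 \<le> y$1 \<and> 0 \<le> y$2 \<and> 0 \<le> y$3 \<and> y$1 + y$2 + y$3 \<le> 1}"
  have K: "v m + h y \<in> tetrahedron v \<longleftrightarrow> y \<in> K" for y
  proof -
    have "v m + h y \<in> tetrahedron v \<longleftrightarrow> (\<forall>n\<in>{0, i, j, m}. 0 \<le> ?p y n)"
      using affine_combination_in_tetrahedron_iff[OF v simplex_point_sum[OF ijm], of y]
      unfolding comb unfolding opp(7) .
    also have "\<dots> \<longleftrightarrow> y \<in> K"
      using opp(1-6) by (auto simp: K_def simplex_point_def)
    finally show ?thesis .
  qed
  have "linear h" unfolding h_def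
    by (intro linearI) (simp_all add: algebra_simps)
  moreover have "inj h"
  proof (rule injI)
    fix y z assume "h y = h z"
    then have p: "?p y = ?p z" using bary by metis
    show "y = z" unfolding vec_eq_iff forall_3
      using fun_cong[OF p, of 0] fun_cong[OF p, of i] fun_cong[OF p, of j] opp(1-6)
      by (simp add: simplex_point_def)
  qed
  ultimately obtain c where c: "c \<noteq> 0" "c < \<infinity>" and
    subst: "\<And>f. (\<lambda>y. f (v m + h y)) \<in> borel_measurable borel \<Longrightarrow>
       (\<integral>\<^sup>+x. f x \<partial>lborel) = c * (\<integral>\<^sup>+y. f (v m + h y) \<partial>lborel)"
    by (rule nn_integral_affine_substitution[where b = "v m"]) blast
  have "closed K" unfolding K_def by (intro closed_Collect_conj closed_Collect_le continuous_intros)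
  then have [measurable]: "K \<in> sets borel" by simp
  have [measurable]: "(\<lambda>y. ?p y n) \<in> borel_measurable borel" for n
    unfolding simplex_point_def by measurable
  define F where "F \<alpha> \<gamma> y = ennreal (\<Prod>n=0..3. ?p y n ^ \<alpha> n) / ennreal (\<Prod>n=1..3. (?p y 0 + ?p y n) ^ \<gamma> n)" for \<alpha> \<gamma> y
  have [measurable]: "F \<alpha> \<gamma> \<in> borel_measurable borel" for \<alpha> \<gamma> unfolding F_def by measurable
  let ?T = "emeasure lborel (tetrahedron v)"
  have T: "?T \<noteq> 0" "?T \<noteq> \<infinity>"
  proof -
    have comp: "compact (tetrahedron v)" unfolding tetrahedron_def
      by (intro finite_imp_compact_convex_hull) simp
    then show "?T \<noteq> \<infinity>" using emeasure_compact_finite[OF comp] by simp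
    have ind: "indicator (tetrahedron v) (v m + h y) = (indicator K y :: ennreal)" for y
      by (simp add: indicator_def K)
    have "?T = (\<integral>\<^sup>+x. indicator (tetrahedron v) x \<partial>lborel)"
      using comp by (simp add: borel_compact)
    also have "\<dots> = c * (\<integral>\<^sup>+y. indicator K y \<partial>lborel)"
      by (subst subst) (simp_all add: ind)
    finally have "?T = c * emeasure lborel K" by simp
    moreover have "emeasure lborel K \<noteq> 0"
    proof -
      let ?B = "box 0 (\<chi> i. 1/3) :: (real^3) set"
      have "?B \<subseteq> K" unfolding K_def by (auto simp: mem_box_cart forall_3)
      then have "emeasure lborel ?B \<le> emeasure lborel K"
        by (intro emeasure_mono) auto
      moreover have "emeasure lborel ?B > 0"
        by (subst emeasure_box_real3) auto
      ultimately show ?thesis by auto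
    qed
    ultimately show "?T \<noteq> 0" using c by auto
  qed
  show ?thesis
  proof
    show "c / ?T \<noteq> 0" using c T by (auto simp: ennreal_divide_eq_0_iff)
    show "c / ?T < \<infinity>" using c T by (simp add: less_top[symmetric] ennreal_divide_eq_top_iff)
    fix \<alpha> \<gamma>
    have "AE y in lborel :: (real^3) measure. y$n \<noteq> 0" for n
      using AE_lborel_inner_neq[of "axis n (1::real)" 0] by (simp add: cart_eq_inner_axis)
    then have "AE y in lborel. y$1 \<noteq> 0 \<and> y$2 \<noteq> 0 \<and> (y::real^3)$3 \<noteq> 0" by simp
    then have "AE y in lborel. F \<alpha> \<gamma> y * indicator K y
       = ennreal (star_weight \<alpha> \<gamma> (?p y)) * indicator corner_simplex y"
    proof eventually_elim
      case (elim y)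
      show ?case
      proof (cases "y \<in> corner_simplex")
        case True
        then have y: "0 < y$1" "0 < y$2" "0 < y$3" "0 \<le> 1 - y$1 - y$2 - y$3"
          by (auto simp: corner_simplex_def)
        then have p: "0 < ?p y 0" "0 \<le> ?p y n" for n by (auto simp: simplex_point_def)
        have "F \<alpha> \<gamma> y = ennreal (star_weight \<alpha> \<gamma> (?p y))"
          unfolding F_def star_weight_def
          by (intro divide_ennreal prod_nonneg prod_pos zero_le_power zero_less_power ballI add_pos_nonneg p)
        with True show ?thesis by (simp add: K_def corner_simplex_def)
      next
        case False
        then show ?thesis using elim by (auto simp: K_def corner_simplex_def)
      qed
    qed
    then have ae: "(\<integral>\<^sup>+y. F \<alpha> \<gamma> y * indicator K y \<partial>lborel)
       = (\<integral>\<^sup>+y\<in>corner_simplex. ennreal (star_weight \<alpha> \<gamma> (?p y)) \<partial>lborel)"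
      by (rule nn_integral_cong_AE)
    have pull: "(ennreal (\<Prod>n=0..3. barycentric v (v m + h y) n ^ \<alpha> n)
        / ennreal (\<Prod>n=1..3. (barycentric v (v m + h y) 0 + barycentric v (v m + h y) n) ^ \<gamma> n))
        * indicator (tetrahedron v) (v m + h y) = F \<alpha> \<gamma> y * indicator K y" for y
      unfolding bary F_def by (simp only: indicator_def K)
    show "star_moment v \<alpha> \<gamma> = c / ?T *
       (\<integral>\<^sup>+ y \<in> corner_simplex. ennreal (star_weight \<alpha> \<gamma> (?p y)) \<partial>lborel)"
      unfolding star_moment_def ae[symmetric]
      by (subst subst) (simp_all only: pull, measurable, simp add: divide_ennreal_def mult_ac)
  qed
qed


section \<open>Splitting the integrand\<close>

text \<open>
  The factor \<open>u 0 + u k\<close> cancelled from the denominator by lowering \<open>\<gamma> k\<close> is distributed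
  over the numerator.
\<close>

lemma star_weight_split:
  assumes k: "k \<in> {1..3}" and "\<alpha> 0 \<ge> 1" "\<gamma> k \<ge> 1" and nz: "u 0 + u k \<noteq> 0"
  shows "star_weight (\<lambda>i. \<alpha> i - canonical_unit 0 i) (\<lambda>i. \<gamma> i - canonical_unit k i) u =
    star_weight \<alpha> \<gamma> u + star_weight (\<lambda>i. \<alpha> i - canonical_unit 0 i + canonical_unit k i) \<gamma> u"
proof -
  obtain i j where ijk: "{k, i, j} = {1..3}" by (rule complementary_vertices[OF k])
  note opp = opposite_vertices(1-6)[OF ijk]
  obtain a where a: "\<alpha> 0 = Suc a" using assms(2) by (metis Suc_le_D One_nat_def)
  obtain g where g: "\<gamma> k = Suc g" using assms(3) by (metis Suc_le_D One_nat_def)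
  have split: "u 0 ^ a * (u k ^ b / (u 0 + u k) ^ g) =
      u 0 ^ Suc a * (u k ^ b / (u 0 + u k) ^ Suc g) + u 0 ^ a * (u k ^ Suc b / (u 0 + u k) ^ Suc g)" for b
  proof -
    have "u 0 ^ Suc a * (u k ^ b / (u 0 + u k) ^ Suc g) + u 0 ^ a * (u k ^ Suc b / (u 0 + u k) ^ Suc g)
        = ((u 0 + u k) * (u 0 ^ a * u k ^ b)) / ((u 0 + u k) * (u 0 + u k) ^ g)"
      by (simp add: algebra_simps add_divide_distrib)
    then show ?thesis using nz by simp
  qed
  let ?ri = "u i ^ \<alpha> i / (u 0 + u i) ^ \<gamma> i" and ?rj = "u j ^ \<alpha> j / (u 0 + u j) ^ \<gamma> j"
  have "star_weight (\<lambda>i. \<alpha> i - canonical_unit 0 i) (\<lambda>i. \<gamma> i - canonical_unit k i) u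
      = u 0 ^ a * (u k ^ \<alpha> k / (u 0 + u k) ^ g) * ?ri * ?rj"
    and "star_weight \<alpha> \<gamma> u = u 0 ^ Suc a * (u k ^ \<alpha> k / (u 0 + u k) ^ Suc g) * ?ri * ?rj"
    and "star_weight (\<lambda>i. \<alpha> i - canonical_unit 0 i + canonical_unit k i) \<gamma> u
      = u 0 ^ a * (u k ^ Suc (\<alpha> k) / (u 0 + u k) ^ Suc g) * ?ri * ?rj"
    unfolding star_weight_eq[OF ijk] using opp by (simp_all add: canonical_unit_def a g)
  then show ?thesis by (simp only: split[of "\<alpha> k"] distrib_right)
qed

section \<open>The inequalities suffice for finiteness\<close>

text \<open>
  Both \<open>a\<close> and \<open>x\<close> are at most \<open>t = a + x\<close>, so the left-hand side is at most
  \<open>t\<close> to the power \<open>b - 1 + p - q \<ge> -1\<close>, and \<open>t \<le> 1\<close>. The power of \<open>a\<close> is the share of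
  the numerator \<open>\<lambda>\<^sub>0\<close> spent on this factor.
\<close>

lemma power_quotient_le:
  fixes a x :: real
  assumes "0 \<le> x" "0 < a" "a + x \<le> 1" "q \<le> p + b" "b \<ge> 1"
  shows "a ^ (b - 1) * (x ^ p / (a + x) ^ q) \<le> 1 / (a + x)"
proof -
  define t where "t = a + x"
  have t: "0 < t" "a \<le> t" "x \<le> t" "t \<le> 1" using assms by (auto simp: t_def)
  have "t ^ (p + b) \<le> t ^ q" using assms t by (intro power_decreasing) auto
  have "a ^ (b - 1) * x ^ p / t ^ q \<le> t ^ (b - 1) * t ^ p / t ^ q"
    using assms t by (intro divide_right_mono mult_mono power_mono) auto
  also have "\<dots> \<le> t ^ (b - 1) * t ^ p / t ^ (p + b)"
    using t \<open>t ^ (p + b) \<le> t ^ q\<close> by (intro divide_left_mono) auto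
  also have "\<dots> = 1 / t"
    using t \<open>b \<ge> 1\<close> by (cases b) (auto simp: power_add field_simps)
  finally show ?thesis by (simp add: t_def)
qed

lemma star_factor_le:
  fixes a x :: real
  assumes "0 \<le> x" "0 < a" "a + x \<le> 1" "1/4 \<le> a + x"
  shows "x ^ p / (a + x) ^ q \<le> 4 ^ q"
proof -
  have "x ^ p / (a + x) ^ q \<le> 1 / (1/4) ^ q"
    using assms by (intro frac_le power_le_one power_mono) auto
  then show ?thesis by (simp add: power_divide)
qed

definition star_kernel :: "(nat \<Rightarrow> real) \<Rightarrow> nat \<Rightarrow> nat \<Rightarrow> real" where
  "star_kernel u i j = 1 / ((u 0 + u i) * (u 0 + u j))"

text \<open>
  Near an edge or vertex of the face opposite to vertex 0, where \<open>u m\<close> stays away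
  from 0: the factor of index \<open>m\<close> is bounded, and the \<open>\<alpha> 0\<close> available powers of \<open>u 0\<close> are divided
  between the factors of index \<open>i\<close> and \<open>j\<close>. That such a division exists is precisely what the
  three inequalities say.
\<close>

lemma star_weight_le_kernel:
  assumes ijm: "{i, j, m} = {1..3::nat}"
    and u: "0 < u 0" "\<And>n. 0 \<le> u n" "u 0 + u i + u j + u m = 1"
    and big: "1/4 \<le> u m"
    and "\<gamma> i \<le> \<alpha> 0 + \<alpha> i + 1" "\<gamma> j \<le> \<alpha> 0 + \<alpha> j + 1" "\<gamma> i + \<gamma> j \<le> \<alpha> 0 + \<alpha> i + \<alpha> j + 2"
  shows "star_weight \<alpha> \<gamma> u \<le> 4 ^ \<gamma> m * star_kernel u i j"
proof -
  \<comment> \<open>Each of the two factors may retain one inverse power, hence the shares \<open>b - 1\<close> and \<open>c - 1\<close>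
      with \<open>b + c = \<alpha> 0 + 2\<close>; \<open>b\<close> is chosen as small as the factor of index \<open>i\<close> permits.\<close>
  define b where "b = max 1 (\<gamma> i - \<alpha> i)"
  define c where "c = \<alpha> 0 + 2 - b"
  have bc: "b \<ge> 1" "c \<ge> 1" "\<gamma> i \<le> \<alpha> i + b" "\<gamma> j \<le> \<alpha> j + c" "\<alpha> 0 = (b - 1) + (c - 1)"
    using assms(6-) by (auto simp: b_def c_def max_def)
  have le1: "u 0 + u i \<le> 1" "u 0 + u j \<le> 1" "u 0 + u m \<le> 1" using u(2)[of i] u(2)[of j] u(2)[of m] u(1,3) by linarith+
  have "star_weight \<alpha> \<gamma> u = (u 0 ^ (b - 1) * (u i ^ \<alpha> i / (u 0 + u i) ^ \<gamma> i))
     * (u 0 ^ (c - 1) * (u j ^ \<alpha> j / (u 0 + u j) ^ \<gamma> j)) * (u m ^ \<alpha> m / (u 0 + u m) ^ \<gamma> m)"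
    unfolding star_weight_eq[OF ijm] by (subst bc(5)) (simp add: power_add)
  also have "\<dots> \<le> (1 / (u 0 + u i)) * (1 / (u 0 + u j)) * 4 ^ \<gamma> m"
    using u(1,2) le1 bc big
    by (intro mult_mono power_quotient_le star_factor_le)
       (auto intro!: mult_nonneg_nonneg divide_nonneg_nonneg zero_le_power add_nonneg_nonneg less_imp_le)
  finally show ?thesis by (simp add: star_kernel_def)
qed

text \<open>
  The coordinates sum to 1, so one of them is at least 1/4. If it is \<open>u 0\<close>, the integrand is
  bounded outright; otherwise the previous bound applies.
\<close>

lemma star_weight_le_sum_kernels:
  assumes u: "0 < u 0" "\<And>n. 0 \<le> u n" "u 0 + u 1 + u 2 + u 3 = 1"
    and single: "\<And>i. i \<in> {1..3} \<Longrightarrow> \<gamma> i \<le> \<alpha> 0 + \<alpha> i + 1"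
    and pair: "\<And>i j. i \<in> {1..3} \<Longrightarrow> j \<in> {1..3} \<Longrightarrow> i < j \<Longrightarrow> \<gamma> i + \<gamma> j \<le> \<alpha> 0 + \<alpha> i + \<alpha> j + 2"
  shows "star_weight \<alpha> \<gamma> u \<le>
    4 ^ (\<gamma> 1 + \<gamma> 2 + \<gamma> 3) * (star_kernel u 1 2 + star_kernel u 1 3 + star_kernel u 2 3)"
proof -
  let ?K = "4 ^ (\<gamma> 1 + \<gamma> 2 + \<gamma> 3) :: real"
  have k0: "0 \<le> star_kernel u i j" for i j using u(2) by (simp add: star_kernel_def)
  have le1: "u 0 \<le> 1" "u 0 + u 1 \<le> 1" "u 0 + u 2 \<le> 1" "u 0 + u 3 \<le> 1"
    using u(2)[of 1] u(2)[of 2] u(2)[of 3] u(1,3) by linarith+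
  have *: "?thesis" if "star_weight \<alpha> \<gamma> u \<le> 4 ^ q * star_kernel u i j" "q \<le> \<gamma> 1 + \<gamma> 2 + \<gamma> 3"
    "(i, j) \<in> {(1,2), (1,3), (2,3)}" for i j q
  proof -
    have "4 ^ q * star_kernel u i j \<le> ?K * (star_kernel u 1 2 + star_kernel u 1 3 + star_kernel u 2 3)"
      using that(2,3) k0 by (intro mult_mono power_increasing) (auto intro: add_nonneg_nonneg)
    with that(1) show ?thesis by linarith
  qed
  consider "1/4 \<le> u 0" | "1/4 \<le> u 1" | "1/4 \<le> u 2" | "1/4 \<le> u 3" using u(3) by linarith
  then show ?thesis
  proof cases
    case 1
    have s: "{1, 2, 3} = {1..3::nat}" by auto
    have "star_weight \<alpha> \<gamma> u \<le> 1 * 4 ^ \<gamma> 1 * 4 ^ \<gamma> 2 * 4 ^ \<gamma> 3"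
      unfolding star_weight_eq[OF s] using u(1,2) le1 1
      by (intro mult_mono star_factor_le power_le_one)
        (auto intro!: mult_nonneg_nonneg divide_nonneg_nonneg zero_le_power add_nonneg_nonneg less_imp_le simp: add_increasing2)
    also have "\<dots> = ?K * 1" by (simp add: power_add)
    also have "\<dots> \<le> ?K * star_kernel u 1 2"
      using le1 u(1) u(2)[of 1] u(2)[of 2]
      by (intro mult_left_mono) (auto simp: star_kernel_def intro!: mult_le_one mult_pos_pos add_pos_nonneg)
    finally show ?thesis by (intro *[of _ 1 2]) auto
  next
    case 2
    have s: "{2, 3, 1} = {1..3::nat}" by auto
    show ?thesis by (rule *[OF star_weight_le_kernel[OF s u(1,2) _ 2]]) (use u(3) single pair in auto)
  next
    case 3
    have s: "{1, 3, 2} = {1..3::nat}" by auto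
    show ?thesis by (rule *[OF star_weight_le_kernel[OF s u(1,2) _ 3]]) (use u(3) single pair in auto)
  next
    case 4
    have s: "{1, 2, 3} = {1..3::nat}" by auto
    show ?thesis by (rule *[OF star_weight_le_kernel[OF s u(1,2) _ 4]]) (use u(3) single pair in auto)
  qed
qed

text \<open>
  Weighted means: \<open>a + x\<close> dominates \<open>a\<^sup>1\<^sup>/\<^sup>3 x\<^sup>2\<^sup>/\<^sup>3\<close>. The weights are those for which all three
  variables receive the same exponent, -2/3 > -1.
\<close>

lemma inverse_product_le_powr:
  fixes a x y :: real
  assumes "0 < a" "0 < x" "0 < y"
  shows "1 / ((a + x) * (a + y)) \<le> a powr (-2/3) * x powr (-2/3) * y powr (-2/3)"
proof -
  have *: "a powr (1/3) * t powr (2/3) \<le> a + t" if "0 < t" for t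
  proof -
    have "a powr (1/3) * t powr (2/3) \<le> (a + t) powr (1/3) * (a + t) powr (2/3)"
      using assms that by (intro mult_mono powr_mono2) auto
    also have "\<dots> = a + t" using assms that by (simp add: powr_add[symmetric])
    finally show ?thesis .
  qed
  have "1 / ((a + x) * (a + y)) \<le> 1 / ((a powr (1/3) * x powr (2/3)) * (a powr (1/3) * y powr (2/3)))"
    using assms by (intro divide_left_mono mult_mono * mult_pos_pos) auto
  also have "(a powr (1/3) * x powr (2/3)) * (a powr (1/3) * y powr (2/3))
     = a powr (2/3) * x powr (2/3) * y powr (2/3)"
    using powr_add[of a "1/3" "1/3"] by simp
  also have "1 / \<dots> = a powr (-2/3) * x powr (-2/3) * y powr (-2/3)"
    by (simp add: powr_minus field_simps)
  finally show ?thesis .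
qed

lemma nn_integral_product_powr_finite:
  "(\<integral>\<^sup>+y\<in>corner_simplex. ennreal ((y::real^3)$1 powr (-2/3) * y$2 powr (-2/3) * y$3 powr (-2/3)) \<partial>lborel) < \<infinity>"
proof -
  define f where "f = (\<lambda>t::real. if t \<in> {0..1} then t powr (-2/3) else 0)"
  have [measurable]: "f \<in> borel_measurable borel" unfolding f_def by measurable
  have f0: "0 \<le> f t" for t by (simp add: f_def)
  have "((\<lambda>t::real. t powr (-2/3)) has_integral 3) {0..1}"
    using has_integral_powr_from_0[of "-2/3" 1] by simp
  then have "(f has_integral 3) UNIV"
    unfolding f_def by (simp only: has_integral_restrict_UNIV)
  then have I: "(\<integral>\<^sup>+t. ennreal (f t) \<partial>lborel) = ennreal 3"
    by (intro nn_integral_has_integral_lborel f0) auto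
  have "(\<integral>\<^sup>+y\<in>corner_simplex. ennreal ((y::real^3)$1 powr (-2/3) * y$2 powr (-2/3) * y$3 powr (-2/3)) \<partial>lborel)
     \<le> (\<integral>\<^sup>+y. (\<Prod>b\<in>Basis. ennreal (f ((y::real^3) \<bullet> b))) \<partial>lborel)"
  proof (intro nn_integral_mono)
    fix y :: "real^3"
    show "ennreal (y$1 powr (-2/3) * y$2 powr (-2/3) * y$3 powr (-2/3)) * indicator corner_simplex y
       \<le> (\<Prod>b\<in>Basis. ennreal (f (y \<bullet> b)))"
    proof (cases "y \<in> corner_simplex")
      case True
      then have "f (y$1) = y$1 powr (-2/3)" "f (y$2) = y$2 powr (-2/3)" "f (y$3) = y$3 powr (-2/3)"
        by (auto simp: f_def corner_simplex_def)
      with True show ?thesis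
        by (simp add: prod_Basis_real3 inner_axis ennreal_mult[symmetric] f0 del: ennreal_mult)
    qed simp
  qed
  also have "\<dots> = (\<Prod>b\<in>(Basis :: (real^3) set). \<integral>\<^sup>+t. ennreal (f t) \<partial>lborel)"
    by (intro nn_integral_lborel_prod) auto
  also have "\<dots> < \<infinity>" unfolding I by (simp add: prod_Basis_real3 ennreal_mult_less_top)
  finally show ?thesis .
qed


section \<open>The inequalities are necessary for finiteness\<close>

lemma nn_integral_infinite_if_blocks:
  assumes B: "\<And>n::nat. B n \<in> sets M" and disj: "disjoint_family B"
    and f: "\<And>n x. x \<in> B n \<Longrightarrow> c n \<le> f x"
    and e: "e > 0" "\<And>n. e \<le> c n * emeasure M (B n)"
  shows "(\<integral>\<^sup>+x. f x \<partial>M) = \<infinity>"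
proof -
  have "(\<Sum>n. c n * indicator (B n) x) \<le> f x" for x
  proof (cases "\<exists>n. x \<in> B n")
    case True
    then obtain n where n: "x \<in> B n" by blast
    have "x \<notin> B k" if "k \<noteq> n" for k using disj n that by (auto simp: disjoint_family_on_def)
    then have "(\<Sum>k. c k * indicator (B k) x) = (\<Sum>k\<in>{n}. c k * indicator (B k) x)"
      by (intro suminf_finite) auto
    with n f[of x n] show ?thesis by simp
  qed simp
  then have "(\<integral>\<^sup>+x. (\<Sum>n. c n * indicator (B n) x) \<partial>M) \<le> (\<integral>\<^sup>+x. f x \<partial>M)"
    by (intro nn_integral_mono) auto
  also have "(\<integral>\<^sup>+x. (\<Sum>n. c n * indicator (B n) x) \<partial>M) = (\<Sum>n. c n * emeasure M (B n))"
    using B by (subst nn_integral_suminf) (auto simp: nn_integral_cmult_indicator)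
  finally have le: "(\<Sum>n. c n * emeasure M (B n)) \<le> (\<integral>\<^sup>+x. f x \<partial>M)" .
  have "(\<Sum>n. e) \<le> (\<Sum>n. c n * emeasure M (B n))"
    by (intro suminf_le e(2)) auto
  moreover have "(\<Sum>n::nat. e) = \<infinity>"
    unfolding nn_integral_count_space_nat[symmetric] using e(1) by (simp add: ennreal_mult_top)
  ultimately show ?thesis using le by (simp add: top_unique)
qed

text \<open>
  The set \<open>(s/2, s) \<times> (s/2, s) \<times> (r/2, r)\<close>. As \<open>s\<close> tends to 0, blocks with \<open>r\<close> constant approach
  an edge of the tetrahedron, and blocks with \<open>r = s\<close> approach a vertex of it.
\<close>

definition dyadic_block :: "real \<Rightarrow> real \<Rightarrow> (real^3) set" where
  "dyadic_block s r = box (vector [s/2, s/2, r/2]) (vector [s, s, r])"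

lemma mem_dyadic_block:
  "y \<in> dyadic_block s r \<longleftrightarrow> s/2 < y$1 \<and> y$1 < s \<and> s/2 < y$2 \<and> y$2 < s \<and> r/2 < y$3 \<and> y$3 < r"
  by (auto simp: dyadic_block_def mem_box_cart forall_3)

lemma emeasure_dyadic_block:
  assumes "0 < s" "0 < r"
  shows "emeasure lborel (dyadic_block s r) = ennreal (s\<^sup>2 * r / 8)"
proof -
  have "\<forall>i. (vector [s/2, s/2, r/2] :: real^3) $ i \<le> (vector [s, s, r] :: real^3) $ i"
    using assms by (simp add: forall_3)
  then have "emeasure lborel (dyadic_block s r) = ennreal ((s - s/2) * (s - s/2) * (r - r/2))"
    unfolding dyadic_block_def
    by (subst emeasure_box_real3) auto
  then show ?thesis by (simp add: power2_eq_square)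
qed

text \<open>
  On a block every coordinate is comparable to \<open>s\<close>, \<open>r\<close> or 1, up to a factor of at most 4 that
  \<open>\<kappa>\<close> accounts for.
\<close>

lemma star_weight_ge_on_block:
  fixes \<alpha> \<gamma> :: "nat \<Rightarrow> nat"
  assumes ijm: "{i, j, m} = {1..3::nat}" and sr: "0 < s" "s \<le> r" "r \<le> 1/4"
    and y: "y \<in> dyadic_block s r"
  defines "\<kappa> \<equiv> 1 / (2 ^ (\<alpha> 0 + \<alpha> i + \<alpha> j + \<gamma> i + \<gamma> j) * 4 ^ \<alpha> m)"
  shows "\<kappa> * (s ^ (\<alpha> 0 + \<alpha> i) * r ^ \<alpha> j / (s ^ \<gamma> i * r ^ \<gamma> j)) \<le> star_weight \<alpha> \<gamma> (simplex_point i j m y)"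
proof -
  let ?u = "simplex_point i j m y"
  note opp = opposite_vertices(1-6)[OF ijm]
  have y: "s/2 < y$1" "y$1 < s" "s/2 < y$2" "y$2 < s" "r/2 < y$3" "y$3 < r"
    using y by (auto simp: mem_dyadic_block)
  have u: "?u 0 = y$1" "?u i = y$2" "?u j = y$3" "?u m = 1 - y$1 - y$2 - y$3"
    using opp by (auto simp: simplex_point_def)
  have z: "1/4 \<le> ?u m" "?u 0 + ?u m \<le> 1" using y sr u by linarith+
  have "(s/2) ^ \<alpha> 0 * ((s/2) ^ \<alpha> i / (2 * s) ^ \<gamma> i) * ((r/2) ^ \<alpha> j / (2 * r) ^ \<gamma> j) * ((1/4) ^ \<alpha> m / 1 ^ \<gamma> m)
      \<le> star_weight \<alpha> \<gamma> ?u"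
    unfolding star_weight_eq[OF ijm] using y z sr u
    by (intro mult_mono frac_le power_mono) (auto intro!: mult_nonneg_nonneg divide_nonneg_nonneg zero_le_power)
  moreover have "(s/2) ^ \<alpha> 0 * ((s/2) ^ \<alpha> i / (2 * s) ^ \<gamma> i) * ((r/2) ^ \<alpha> j / (2 * r) ^ \<gamma> j) * ((1/4) ^ \<alpha> m / 1 ^ \<gamma> m)
      = \<kappa> * (s ^ (\<alpha> 0 + \<alpha> i) * r ^ \<alpha> j / (s ^ \<gamma> i * r ^ \<gamma> j))"
    by (simp add: \<kappa>_def power_divide power_mult_distrib power_add)
  ultimately show ?thesis by simp
qed

text \<open>
  The condition on \<open>e\<close> says that the lower bound for the integrand, times the volume \<open>s\<^sup>2 r / 8\<close> of the
  block, stays away from 0.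
\<close>

lemma star_integral_infinite:
  fixes r :: "nat \<Rightarrow> real" and e :: real
  assumes ijm: "{i, j, m} = {1..3::nat}" and e: "e > 0"
    and r: "\<And>n. (1/2) ^ (n + 2) \<le> r n" "\<And>n. r n \<le> 1/4"
    and big: "\<And>n s. s = (1/2) ^ (n + 2) \<Longrightarrow>
      e * (s ^ \<gamma> i * r n ^ \<gamma> j) \<le> s ^ (\<alpha> 0 + \<alpha> i + 2) * r n ^ (\<alpha> j + 1)"
  shows "(\<integral>\<^sup>+ y \<in> corner_simplex. ennreal (star_weight \<alpha> \<gamma> (simplex_point i j m y)) \<partial>lborel) = \<infinity>"
proof -
  define \<kappa> :: real where "\<kappa> = 1 / (2 ^ (\<alpha> 0 + \<alpha> i + \<alpha> j + \<gamma> i + \<gamma> j) * 4 ^ \<alpha> m)"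
  have \<kappa>: "\<kappa> > 0" by (simp add: \<kappa>_def)
  define s :: "nat \<Rightarrow> real" where "s n = (1/2) ^ (n + 2)" for n
  have s: "0 < s n" "s n \<le> r n" "0 < r n" for n
    using r(1)[of n] by (auto simp: s_def intro: less_le_trans[OF _ r(1)])
  define B where "B n = dyadic_block (s n) (r n)" for n
  define c where "c n = \<kappa> * (s n ^ (\<alpha> 0 + \<alpha> i) * r n ^ \<alpha> j / (s n ^ \<gamma> i * r n ^ \<gamma> j))" for n
  show ?thesis
  proof (rule nn_integral_infinite_if_blocks[where B = B and c = "\<lambda>n. ennreal (c n)" and e = "ennreal (\<kappa> * e / 8)"])
    show "B n \<in> sets lborel" for n by (simp add: B_def dyadic_block_def)
    show "disjoint_family B" unfolding disjoint_family_on_def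
    proof safe
      have "False" if "n < k" "y \<in> B n" "y \<in> B k" for n k y
      proof -
        \<comment> \<open>The first coordinates of two blocks lie in disjoint dyadic intervals.\<close>
        have "s k \<le> s (Suc n)" unfolding s_def using \<open>n < k\<close> by (intro power_decreasing) auto
        also have "s (Suc n) = s n / 2" by (simp add: s_def)
        finally show False using that(2,3) by (auto simp: B_def mem_dyadic_block)
      qed
      then show "y \<in> {}" if "n \<noteq> k" "y \<in> B n" "y \<in> B k" for n k y
        using that by (metis linorder_neqE_nat)
    qed
    show "ennreal (c n) \<le> ennreal (star_weight \<alpha> \<gamma> (simplex_point i j m y)) * indicator corner_simplex y"
      if y: "y \<in> B n" for n y
    proof -
      have "y \<in> corner_simplex"
        using y s[of n] r(2)[of n] by (auto simp: B_def mem_dyadic_block corner_simplex_def)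
      moreover have "c n \<le> star_weight \<alpha> \<gamma> (simplex_point i j m y)"
        unfolding c_def \<kappa>_def using star_weight_ge_on_block[OF ijm s(1,2) r(2), of y n] y
        by (simp add: B_def)
      ultimately show ?thesis by (simp add: ennreal_leI)
    qed
    show "ennreal (\<kappa> * e / 8) > 0" using \<kappa> e by simp
    show "ennreal (\<kappa> * e / 8) \<le> ennreal (c n) * emeasure lborel (B n)" for n
    proof -
      have c0: "0 \<le> c n" using s[of n] \<kappa> by (simp add: c_def)
      have "e \<le> s n ^ (\<alpha> 0 + \<alpha> i + 2) * r n ^ (\<alpha> j + 1) / (s n ^ \<gamma> i * r n ^ \<gamma> j)"
        using big[OF s_def] s[of n] by (simp add: pos_le_divide_eq)
      then have "\<kappa> / 8 * e \<le> \<kappa> / 8 * (s n ^ (\<alpha> 0 + \<alpha> i + 2) * r n ^ (\<alpha> j + 1) / (s n ^ \<gamma> i * r n ^ \<gamma> j))"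
        using \<kappa> by (intro mult_left_mono) auto
      also have "\<dots> = c n * ((s n)\<^sup>2 * r n / 8)"
        by (simp add: c_def power_add power2_eq_square mult_ac)
      finally have "\<kappa> * e / 8 \<le> c n * ((s n)\<^sup>2 * r n / 8)" by simp
      then show ?thesis
        unfolding B_def emeasure_dyadic_block[OF s(1,3)]
        using c0 by (simp add: ennreal_mult'[symmetric] ennreal_leI)
    qed
  qed
qed

text \<open>
  The blocks approach the edge on which \<open>\<lambda>\<^sub>0\<close> and \<open>\<lambda>\<^sub>i\<close> vanish: the integrand grows at least
  like \<open>1 / s\<^sup>2\<close> while the volume decreases like \<open>s\<^sup>2\<close>.
\<close>

lemma star_moment_finite_imp_single:
  assumes v: "tetrahedron_vertices v" and fin: "star_moment v \<alpha> \<gamma> < \<infinity>" and i: "i \<in> {1..3}"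
  shows "\<gamma> i \<le> \<alpha> 0 + \<alpha> i + 1"
proof (rule ccontr)
  assume "\<not> ?thesis"
  then have g: "\<alpha> 0 + \<alpha> i + 2 \<le> \<gamma> i" by simp
  obtain j m where ijm: "{i, j, m} = {1..3}" by (rule complementary_vertices[OF i])
  have "(\<integral>\<^sup>+ y \<in> corner_simplex. ennreal (star_weight \<alpha> \<gamma> (simplex_point i j m y)) \<partial>lborel) = \<infinity>"
  proof (rule star_integral_infinite[OF ijm, where r = "\<lambda>_. 1/4" and e = "(1/4) ^ (\<alpha> j + 1)"])
    show "(1/2::real) ^ (n + 2) \<le> 1/4" for n by (simp add: power_le_one)
    fix n and s :: real assume s: "s = (1/2) ^ (n + 2)"
    have s01: "0 \<le> s" "s \<le> 1" unfolding s by (auto intro!: power_le_one simp del: power_Suc)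
    have "s ^ \<gamma> i \<le> s ^ (\<alpha> 0 + \<alpha> i + 2)" using g by (intro power_decreasing s01)
    moreover have "(1/4::real) ^ \<gamma> j \<le> 1" by (simp add: power_le_one)
    ultimately have "s ^ \<gamma> i * (1/4) ^ \<gamma> j \<le> s ^ (\<alpha> 0 + \<alpha> i + 2) * 1"
      using s01 by (intro mult_mono) auto
    then show "(1/4) ^ (\<alpha> j + 1) * (s ^ \<gamma> i * (1/4) ^ \<gamma> j) \<le> s ^ (\<alpha> 0 + \<alpha> i + 2) * (1/4) ^ (\<alpha> j + 1)"
      by (subst mult.commute, intro mult_right_mono) auto
  qed auto
  moreover obtain C where "C \<noteq> 0" "C < \<infinity>" "\<And>\<alpha> \<gamma>. star_moment v \<alpha> \<gamma> =
       C * (\<integral>\<^sup>+ y \<in> corner_simplex. ennreal (star_weight \<alpha> \<gamma> (simplex_point i j m y)) \<partial>lborel)"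
    by (rule star_moment_chart[OF v ijm]) blast
  ultimately show False using fin by (simp add: ennreal_mult_top)
qed

text \<open>
  The blocks approach vertex \<open>m\<close>, where \<open>\<lambda>\<^sub>0\<close>, \<open>\<lambda>\<^sub>i\<close> and \<open>\<lambda>\<^sub>j\<close> vanish: the integrand grows at
  least like \<open>1 / s\<^sup>3\<close> while the volume decreases like \<open>s\<^sup>3\<close>.
\<close>

lemma star_moment_finite_imp_pair:
  assumes v: "tetrahedron_vertices v" and fin: "star_moment v \<alpha> \<gamma> < \<infinity>"
    and ij: "i \<in> {1..3}" "j \<in> {1..3}" "i \<noteq> j"
  shows "\<gamma> i + \<gamma> j \<le> \<alpha> 0 + \<alpha> i + \<alpha> j + 2"
proof (rule ccontr)
  assume "\<not> ?thesis"
  then have g: "\<alpha> 0 + \<alpha> i + 2 + (\<alpha> j + 1) \<le> \<gamma> i + \<gamma> j" by simp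
  obtain m where ijm: "{i, j, m} = {1..3}" by (rule complementary_vertex[OF ij])
  have "(\<integral>\<^sup>+ y \<in> corner_simplex. ennreal (star_weight \<alpha> \<gamma> (simplex_point i j m y)) \<partial>lborel) = \<infinity>"
  proof (rule star_integral_infinite[OF ijm, where r = "\<lambda>n. (1/2) ^ (n + 2)" and e = 1])
    show "(1/2::real) ^ (n + 2) \<le> 1/4" for n by (simp add: power_le_one)
    fix n and s :: real assume s: "s = (1/2) ^ (n + 2)"
    have s01: "0 \<le> s" "s \<le> 1" unfolding s by (auto intro!: power_le_one simp del: power_Suc)
    have "s ^ (\<gamma> i + \<gamma> j) \<le> s ^ (\<alpha> 0 + \<alpha> i + 2 + (\<alpha> j + 1))"
      using g by (intro power_decreasing s01)
    then show "1 * (s ^ \<gamma> i * ((1/2) ^ (n + 2)) ^ \<gamma> j) \<le> s ^ (\<alpha> 0 + \<alpha> i + 2) * ((1/2) ^ (n + 2)) ^ (\<alpha> j + 1)"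
      unfolding s[symmetric] by (simp add: power_add mult_ac)
  qed auto
  moreover obtain C where "C \<noteq> 0" "C < \<infinity>" "\<And>\<alpha> \<gamma>. star_moment v \<alpha> \<gamma> =
       C * (\<integral>\<^sup>+ y \<in> corner_simplex. ennreal (star_weight \<alpha> \<gamma> (simplex_point i j m y)) \<partial>lborel)"
    by (rule star_moment_chart[OF v ijm]) blast
  ultimately show False using fin by (simp add: ennreal_mult_top)
qed


section \<open>Finite moments and the recurrence\<close>

lemma corner_simplex_borel [measurable]: "corner_simplex \<in> sets borel"
  unfolding corner_simplex_def by measurable

lemma star_weight_chart_measurable [measurable]:
  "(\<lambda>y. star_weight \<alpha> \<gamma> (simplex_point i j m y)) \<in> borel_measurable borel"
  unfolding star_weight_def simplex_point_def by measurable

lemma simplex_point_bounds: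
  assumes "y \<in> corner_simplex"
  shows "0 < simplex_point i j m y 0" "0 \<le> simplex_point i j m y n"
  using assms by (auto simp: simplex_point_def corner_simplex_def)

text \<open>
  The dominating kernels are themselves integrands of star moments, so each of them can be
  integrated in the chart that suits it.
\<close>

lemma star_kernel_eq_weight:
  assumes "{i, j, m} = {1..3::nat}"
  shows "star_kernel u i j = star_weight (\<lambda>_. 0) (\<lambda>n. if n \<in> {i, j} then 1 else 0) u"
  unfolding star_weight_eq[OF assms] star_kernel_def using opposite_vertices(1-6)[OF assms] by simp

lemma star_kernel_moment_finite:
  assumes v: "tetrahedron_vertices v" and ijm: "{i, j, m} = {1..3::nat}"
  shows "star_moment v (\<lambda>_. 0) (\<lambda>n. if n \<in> {i, j} then 1 else 0) < \<infinity>"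
proof -
  obtain C where C: "C \<noteq> 0" "C < \<infinity>" "\<And>\<alpha> \<gamma>. star_moment v \<alpha> \<gamma> =
       C * (\<integral>\<^sup>+ y \<in> corner_simplex. ennreal (star_weight \<alpha> \<gamma> (simplex_point i j m y)) \<partial>lborel)"
    by (rule star_moment_chart[OF v ijm]) blast
  have "(\<integral>\<^sup>+ y \<in> corner_simplex. ennreal (star_kernel (simplex_point i j m y) i j) \<partial>lborel)
     \<le> (\<integral>\<^sup>+y\<in>corner_simplex. ennreal ((y::real^3)$1 powr (-2/3) * y$2 powr (-2/3) * y$3 powr (-2/3)) \<partial>lborel)"
  proof (intro nn_integral_mono)
    fix y :: "real^3"
    show "ennreal (star_kernel (simplex_point i j m y) i j) * indicator corner_simplex y
       \<le> ennreal (y$1 powr (-2/3) * y$2 powr (-2/3) * y$3 powr (-2/3)) * indicator corner_simplex y"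
    proof (cases "y \<in> corner_simplex")
      case True
      then have "0 < y$1" "0 < y$2" "0 < y$3" by (auto simp: corner_simplex_def)
      from inverse_product_le_powr[OF this] True show ?thesis
        using opposite_vertices(1-6)[OF ijm] by (simp add: star_kernel_def simplex_point_def ennreal_leI)
    qed simp
  qed
  also have "\<dots> < \<infinity>" by (rule nn_integral_product_powr_finite)
  finally show ?thesis
    using C(2) unfolding C(3) star_kernel_eq_weight[OF ijm] by (simp add: ennreal_mult_less_top)
qed

text \<open>
  The sum of kernels is integrated in a single chart; the three resulting moments are then
  recognised as the finite ones above.
\<close>

lemma star_moment_finiteI:
  assumes v: "tetrahedron_vertices v"
    and single: "\<And>i. i \<in> {1..3} \<Longrightarrow> \<gamma> i \<le> \<alpha> 0 + \<alpha> i + 1"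
    and pair: "\<And>i j. i \<in> {1..3} \<Longrightarrow> j \<in> {1..3} \<Longrightarrow> i < j \<Longrightarrow> \<gamma> i + \<gamma> j \<le> \<alpha> 0 + \<alpha> i + \<alpha> j + 2"
  shows "star_moment v \<alpha> \<gamma> < \<infinity>"
proof -
  have perm: "{1, 2, 3} = {1..3::nat}" "{1, 3, 2} = {1..3::nat}" "{2, 3, 1} = {1..3::nat}" by auto
  obtain C where C: "C \<noteq> 0" "C < \<infinity>" "\<And>\<alpha> \<gamma>. star_moment v \<alpha> \<gamma> =
       C * (\<integral>\<^sup>+ y \<in> corner_simplex. ennreal (star_weight \<alpha> \<gamma> (simplex_point 1 2 3 y)) \<partial>lborel)"
    by (rule star_moment_chart[OF v perm(1)]) blast
  define K :: real where "K = 4 ^ (\<gamma> 1 + \<gamma> 2 + \<gamma> 3)"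
  have K: "0 \<le> K" by (simp add: K_def)
  let ?p = "simplex_point 1 2 3"
  define k where "k i j y = ennreal (star_kernel (?p y) i j) * indicator corner_simplex y" for i j y
  have mom: "star_moment v (\<lambda>_. 0) (\<lambda>n. if n \<in> {i, j} then 1 else 0) = C * integral\<^sup>N lborel (k i j)"
    if "{i, j, m} = {1..3}" for i j m
    unfolding C(3) k_def star_kernel_eq_weight[OF that] ..
  have [measurable]: "k i j \<in> borel_measurable borel" for i j
    unfolding k_def star_kernel_def simplex_point_def by measurable
  have "(\<integral>\<^sup>+ y \<in> corner_simplex. ennreal (star_weight \<alpha> \<gamma> (?p y)) \<partial>lborel)
     \<le> (\<integral>\<^sup>+ y. ennreal K * (k 1 2 y + k 1 3 y + k 2 3 y) \<partial>lborel)"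
  proof (intro nn_integral_mono)
    fix y
    show "ennreal (star_weight \<alpha> \<gamma> (?p y)) * indicator corner_simplex y \<le> ennreal K * (k 1 2 y + k 1 3 y + k 2 3 y)"
    proof (cases "y \<in> corner_simplex")
      case True
      note p = simplex_point_bounds[of y 1 2 3, OF True]
      have ker: "0 \<le> star_kernel (?p y) i j" for i j using p(2) by (simp add: star_kernel_def)
      have "?p y 0 + ?p y 1 + ?p y 2 + ?p y 3 = 1"
        using simplex_point_sum(1)[OF perm(1), of y] unfolding sum_vertices[OF perm(1)] .
      from star_weight_le_sum_kernels[where \<alpha> = \<alpha> and \<gamma> = \<gamma>, OF p this single pair]
      have "ennreal (star_weight \<alpha> \<gamma> (?p y))
          \<le> ennreal (K * (star_kernel (?p y) 1 2 + star_kernel (?p y) 1 3 + star_kernel (?p y) 2 3))"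
        unfolding K_def by (intro ennreal_leI) auto
      with True ker K show ?thesis
        by (simp add: k_def ennreal_mult ennreal_plus add_nonneg_nonneg)
    qed simp
  qed
  also have "\<dots> = ennreal K * (integral\<^sup>N lborel (k 1 2) + integral\<^sup>N lborel (k 1 3) + integral\<^sup>N lborel (k 2 3))"
    by (simp add: nn_integral_cmult nn_integral_add)
  finally have "star_moment v \<alpha> \<gamma> \<le> C * \<dots>" unfolding C(3) by (rule mult_left_mono) simp
  also have "\<dots> = ennreal K * (C * integral\<^sup>N lborel (k 1 2) + C * integral\<^sup>N lborel (k 1 3) + C * integral\<^sup>N lborel (k 2 3))"
    by (simp add: distrib_left mult_ac)
  also have "\<dots> < \<infinity>"
    using star_kernel_moment_finite[OF v perm(1)] star_kernel_moment_finite[OF v perm(2)]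
      star_kernel_moment_finite[OF v perm(3)]
    unfolding mom[OF perm(1)] mom[OF perm(2)] mom[OF perm(3)]
    unfolding infinity_ennreal_def by (subst ennreal_mult_less_top) simp
  finally show ?thesis .
qed

text \<open>
  The equation is stated as a sum in \<open>[0,\<infinity>]\<close>, where it is true of infinite moments too.
\<close>

lemma star_moment_split:
  assumes v: "tetrahedron_vertices v" and k: "k \<in> {1..3}" and "\<alpha> 0 \<ge> 1" "\<gamma> k \<ge> 1"
  shows "star_moment v (\<lambda>i. \<alpha> i - canonical_unit 0 i) (\<lambda>i. \<gamma> i - canonical_unit k i) =
    star_moment v \<alpha> \<gamma> + star_moment v (\<lambda>i. \<alpha> i - canonical_unit 0 i + canonical_unit k i) \<gamma>"
proof -
  have perm: "{1, 2, 3} = {1..3::nat}" by auto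
  obtain C where C: "C \<noteq> 0" "C < \<infinity>" "\<And>\<alpha> \<gamma>. star_moment v \<alpha> \<gamma> =
       C * (\<integral>\<^sup>+ y \<in> corner_simplex. ennreal (star_weight \<alpha> \<gamma> (simplex_point 1 2 3 y)) \<partial>lborel)"
    by (rule star_moment_chart[OF v perm]) blast
  let ?w = "\<lambda>\<alpha> \<gamma> y. ennreal (star_weight \<alpha> \<gamma> (simplex_point 1 2 3 y)) * indicator corner_simplex y"
  let ?\<alpha> = "\<lambda>i. \<alpha> i - canonical_unit 0 i" and ?\<gamma> = "\<lambda>i. \<gamma> i - canonical_unit k i"
  let ?\<alpha>k = "\<lambda>i. \<alpha> i - canonical_unit 0 i + canonical_unit k i"
  have eq: "?w ?\<alpha> ?\<gamma> y = ?w \<alpha> \<gamma> y + ?w ?\<alpha>k \<gamma> y" for y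
  proof (cases "y \<in> corner_simplex")
    case True
    note p = simplex_point_bounds[of y 1 2 3, OF True]
    have "0 < simplex_point 1 2 3 y 0 + simplex_point 1 2 3 y k" by (intro add_pos_nonneg p)
    then have "star_weight ?\<alpha> ?\<gamma> (simplex_point 1 2 3 y) =
        star_weight \<alpha> \<gamma> (simplex_point 1 2 3 y) + star_weight ?\<alpha>k \<gamma> (simplex_point 1 2 3 y)"
      using assms by (intro star_weight_split) auto
    moreover have "0 \<le> star_weight \<alpha>' \<gamma>' (simplex_point 1 2 3 y)" for \<alpha>' \<gamma>'
      unfolding star_weight_def by (intro divide_nonneg_nonneg prod_nonneg ballI zero_le_power add_nonneg_nonneg p)
    ultimately show ?thesis using True by (simp add: ennreal_plus)
  qed simp
  show ?thesis unfolding C(3) eq by (subst nn_integral_add) (simp_all add: distrib_left)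
qed

theorem lemma4p7:
  fixes v :: "nat \<Rightarrow> real^3" and \<alpha> \<gamma> :: "nat \<Rightarrow> nat" and k :: nat
  assumes "tetrahedron_vertices v"
    and "star_moment v \<alpha> \<gamma> < \<infinity>"
    and "\<alpha> 0 \<ge> 1"
    and "k \<in> {1..3}"
    and "\<gamma> k \<ge> 1"
    and "\<forall>i\<in>{1..3}. \<gamma> i = \<alpha> 0 + \<alpha> i + 1 \<longrightarrow> k = i"
    and "\<forall>i\<in>{1..3}. \<forall>j\<in>{1..3}. i < j \<longrightarrow>
           \<gamma> i + \<gamma> j = \<alpha> 0 + \<alpha> i + \<alpha> j + 2 \<longrightarrow> k = i \<or> k = j"
  shows "star_moment v (\<lambda>i. \<alpha> i - canonical_unit 0 i) (\<lambda>i. \<gamma> i - canonical_unit k i) < \<infinity>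
       \<and> star_moment v (\<lambda>i. \<alpha> i - canonical_unit 0 i + canonical_unit k i) \<gamma> < \<infinity>
       \<and> enn2real (star_moment v \<alpha> \<gamma>) =
           enn2real (star_moment v (\<lambda>i. \<alpha> i - canonical_unit 0 i) (\<lambda>i. \<gamma> i - canonical_unit k i))
           - enn2real (star_moment v (\<lambda>i. \<alpha> i - canonical_unit 0 i + canonical_unit k i) \<gamma>)"
proof -
  note v = assms(1) and fin = assms(2) and k = assms(4)
  define \<beta> where "\<beta> = (\<lambda>i. \<alpha> i - canonical_unit 0 i + canonical_unit k i)"
  \<comment> \<open>Only inequalities not involving \<open>k\<close> become tighter, and those are strict for \<open>\<alpha>\<close>.\<close>
  have up0: "\<beta> 0 + 1 = \<alpha> 0" using k assms(3) by (simp add: \<beta>_def canonical_unit_def)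
  have up: "\<alpha> n \<le> \<beta> n \<and> (k = n \<longrightarrow> \<beta> n = \<alpha> n + 1)" if "n \<in> {1..3}" for n
    using that by (simp add: \<beta>_def canonical_unit_def)
  have fin': "star_moment v \<beta> \<gamma> < \<infinity>"
  proof (rule star_moment_finiteI[OF v])
    fix i :: nat assume i: "i \<in> {1..3}"
    have "\<gamma> i \<le> \<alpha> 0 + \<alpha> i + 1" by (rule star_moment_finite_imp_single[OF v fin i])
    moreover have "\<gamma> i \<noteq> \<alpha> 0 + \<alpha> i + 1 \<or> k = i" using assms(6) i by blast
    ultimately show "\<gamma> i \<le> \<beta> 0 + \<beta> i + 1"
      using up0 up[OF i] by linarith
  next
    fix i j :: nat assume ij: "i \<in> {1..3}" "j \<in> {1..3}" "i < j"
    have "\<gamma> i + \<gamma> j \<le> \<alpha> 0 + \<alpha> i + \<alpha> j + 2"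
      using ij by (intro star_moment_finite_imp_pair[OF v fin]) auto
    moreover have "\<gamma> i + \<gamma> j \<noteq> \<alpha> 0 + \<alpha> i + \<alpha> j + 2 \<or> k = i \<or> k = j" using assms(7) ij by blast
    ultimately show "\<gamma> i + \<gamma> j \<le> \<beta> 0 + \<beta> i + \<beta> j + 2"
      using up0 up[OF ij(1)] up[OF ij(2)] ij(3) by linarith
  qed
  note split = star_moment_split[where \<alpha> = \<alpha> and \<gamma> = \<gamma>, OF v k assms(3,5), folded \<beta>_def]
  show ?thesis
    unfolding \<beta>_def[symmetric] split using fin fin' by (simp add: enn2real_plus)
qed

end
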